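(* Let $(\Sigma^{\infty,+}_{(L)},\sigma_\infty)$ be a nonstationary subshift of finite type (NSFT) given by alphabets $(\mathcal{A}_i)_{i\ge0}$ and matrices $(L_i)_{i\ge0}$ satisfying (A1) and (A2) of the context. Then its topological entropy is given by $$h_{\mathrm{top}}(\sigma_\infty)=\limsup_{n\to\infty}\frac1n\log w(0,n)=\limsup_{n\to\infty}\frac1n\log\big\|L^{(0,n)}\big\|_{(n)},$$ where $\|\cdot\|_{(n)}$ denotes the norm on $\mathbb{R}^{l_0\times l_n}$ given by $\|A\|_{(n)}=\sum_{\alpha,\beta}|A_{\alpha\beta}|$.
   Context: Let $\mathcal{A}_i=\{1,\dots,l_i\}$, $i\ge0$, be finite alphabets and $L_i$ a $0$-$1$-matrix of dimension $l_i\times l_{i+1}$. Standing assumptions: (A1) the sequence $(L_i)$ is reduced: no row or column of any $L_i$ is identically zero; (A2) the sequence $(l_i)$ is bounded. For $n\le m$ let $$w(n,m):=\#\{(x_n,\dots,x_m): x_i\in\mathcal{A}_i\ (n\le i\le m)\text{ and }(L_i)_{x_ix_{i+1}}=1\text{ for }n\le i\le m-1\}.$$ For $n>k$ put $L^{(k,n)}:=L_kL_{k+1}\cdots L_{n-1}$. For $k\ge0$, $\Sigma^{k,+}_{(L)}:=\{(x_k,x_{k+1},\dots):x_i\in\mathcal{A}_i,\ (L_i)_{x_ix_{i+1}}=1\ \forall i\ge k\}$, with metric $d_k(x,y)=0$ if $x=y$, $d_k(x,y)=1$ if $x_k\ne y_k$, and $d_k(x,y)=w(k,l)^{-1}$ if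 $x\neq y$, $x_k=y_k$ and $l=\max\{r\ge k:x_i=y_i,\ i=k,\dots,r\}$. The maps $\sigma_k:\Sigma^{k,+}_{(L)}\to\Sigma^{k+1,+}_{(L)}$ are the left shifts $\sigma_k(x_k,x_{k+1},\dots)=(x_{k+1},x_{k+2},\dots)$. The spaces are compact, the sequence $\sigma_\infty=(\sigma_k)_{k\ge0}$ is equicontinuous, and $(\Sigma^{\infty,+}_{(L)},\sigma_\infty)$ is called an NSFT. Topological entropy. For an equicontinuous sequence $f_\infty=(f_n)_{n\ge0}$ of maps $f_n:X_n\to X_{n+1}$ between compact metric spaces $(X_n,d_n)$, put $f_0^n=f_{n-1}\circ\cdots\circ f_0$, $f_0^0=\mathrm{id}$, $f_0^{-n}=(f_0^n)^{-1}$. Then $h_{\mathrm{top}}(f_\infty):=\sup_{\mathcal{U}_\infty}\limsup_{n\to\infty}\frac1n\log\mathcal{N}\big(\bigvee_{i=0}^{n-1}f_0^{-i}\mathcal{U}_i\big)$, the supremum over all sequences $\mathcal{U}_\infty=(\mathcal{U}_n)$ of open covers $\mathcal{U}_n$ of $X_n$ whose Lebesgue numbers are bounded away from zero, $\mathcal{N}$ being the minimal cardinality of a subcover. Equivalently, $h_{\mathrm{top}}(f_\infty)=\lim_{\varepsilon\searrow0}\limsup_{n\to\infty}\frac1n\log r(n,\varepsilon)$, where $r(n,\varepsilon)$ is either the maximal cardinality of a set $E\subset X_0$ with $d_{0,n}(x,y)\ge\varepsilon$ for distinct $x,y\in E$, or the minimal cardinality of a set $F\subset X_0$ such that each $x\in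 X_0$ has some $y\in F$ with $d_{0,n}(x,y)<\varepsilon$, where $d_{0,n}(x,y)=\max_{0\le i\le n}d_i(f_0^i(x),f_0^i(y))$. *)

theory Defs
  imports "HOL-Analysis.Analysis" "Jordan_Normal_Form.Matrix"
begin

section \<open>Topological entropy of a nonautonomous system\<close>

text \<open>
  A nonautonomous system is given by carriers \<open>X n\<close>, metrics \<open>d n\<close> on them, and maps \<open>f n\<close> from
  \<open>X n\<close> to \<open>X (n + 1)\<close>. The spaces are assumed to be compact; otherwise minimal subcovers need not
  be finite and \<open>min_subcover\<close> is not meaningful.
\<close>

primrec fiter :: "(nat \<Rightarrow> 'a \<Rightarrow> 'a) \<Rightarrow> nat \<Rightarrow> 'a \<Rightarrow> 'a" where
  "fiter f 0 = id"
| "fiter f (Suc n) = f n \<circ> fiter f n"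

definition open_cover :: "'a set \<Rightarrow> ('a \<Rightarrow> 'a \<Rightarrow> real) \<Rightarrow> 'a set set \<Rightarrow> bool" where
  "open_cover X d \<U> \<longleftrightarrow> (\<forall>U\<in>\<U>. openin (Metric_space.mtopology X d) U) \<and> \<Union>\<U> = X"

text \<open>
  As in \<open>Metric_space.lebesgue_number\<close>, Lebesgue numbers are expressed through balls; the version
  with sets of small diameter gives the same notion of being bounded away from zero.
\<close>

definition lebesgue_number_of :: "'a set \<Rightarrow> ('a \<Rightarrow> 'a \<Rightarrow> real) \<Rightarrow> 'a set set \<Rightarrow> real \<Rightarrow> bool" where
  "lebesgue_number_of X d \<U> \<delta> \<longleftrightarrow>
     \<delta> > 0 \<and> (\<forall>x\<in>X. \<exists>U\<in>\<U>. Metric_space.mball X d x \<delta> \<subseteq> U)"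

definition admissible_covers ::
    "(nat \<Rightarrow> 'a set) \<Rightarrow> (nat \<Rightarrow> 'a \<Rightarrow> 'a \<Rightarrow> real) \<Rightarrow> (nat \<Rightarrow> 'a set set) set" where
  "admissible_covers X d =
     {\<U>. (\<forall>n. open_cover (X n) (d n) (\<U> n)) \<and>
         (\<exists>\<delta>>0. \<forall>n. lebesgue_number_of (X n) (d n) (\<U> n) \<delta>)}"

definition preimage_cover :: "'a set \<Rightarrow> ('a \<Rightarrow> 'b) \<Rightarrow> 'b set set \<Rightarrow> 'a set set" where
  "preimage_cover X g \<U> = (\<lambda>U. {x \<in> X. g x \<in> U}) ` \<U>"

definition cover_join :: "'a set \<Rightarrow> nat \<Rightarrow> (nat \<Rightarrow> 'a set set) \<Rightarrow> 'a set set" where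
  "cover_join X n \<V> = {X \<inter> (\<Inter>i<n. V i) | V. \<forall>i<n. V i \<in> \<V> i}"

definition min_subcover :: "'a set \<Rightarrow> 'a set set \<Rightarrow> nat" where
  "min_subcover X \<U> = Inf {card \<V> | \<V>. \<V> \<subseteq> \<U> \<and> finite \<V> \<and> \<Union>\<V> = X}"

definition h_top ::
    "(nat \<Rightarrow> 'a set) \<Rightarrow> (nat \<Rightarrow> 'a \<Rightarrow> 'a \<Rightarrow> real) \<Rightarrow> (nat \<Rightarrow> 'a \<Rightarrow> 'a) \<Rightarrow> ereal" where
  "h_top X d f =
     (SUP \<U>\<in>admissible_covers X d.
        limsup (\<lambda>n. ereal (1 / real n *
          ln (real (min_subcover (X 0)
            (cover_join (X 0) n (\<lambda>i. preimage_cover (X 0) (fiter f i) (\<U> i))))))))"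


section \<open>Nonstationary subshifts of finite type\<close>

text \<open>
  The alphabets are \<open>{1..l i}\<close>, whereas matrix indices start at \<open>0\<close>, so the entry of \<open>A\<close> belonging to
  the symbols \<open>a\<close> and \<open>b\<close> is \<open>A $$ (a - 1, b - 1)\<close>.
\<close>

definition symb_entry :: "real mat \<Rightarrow> nat \<Rightarrow> nat \<Rightarrow> real" where
  "symb_entry A a b = A $$ (a - 1, b - 1)"

text \<open>
  Words and sequences keep their absolute indices: \<open>(x\<^sub>n, \<dots>, x\<^sub>m)\<close> and \<open>(x\<^sub>k, x\<^sub>k\<^sub>+\<^sub>1, \<dots>)\<close> are extensional
  functions on \<open>{n..m}\<close> and on \<open>{k..}\<close>. The left shift therefore forgets the coordinate \<open>k\<close> and does
  not renumber the others.
\<close>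

definition words :: "(nat \<Rightarrow> nat) \<Rightarrow> (nat \<Rightarrow> real mat) \<Rightarrow> nat \<Rightarrow> nat \<Rightarrow> (nat \<Rightarrow> nat) set" where
  "words l L n m =
     {x \<in> (\<Pi>\<^sub>E i\<in>{n..m}. {1..l i}). \<forall>i\<in>{n..<m}. symb_entry (L i) (x i) (x (Suc i)) = 1}"

definition word_count :: "(nat \<Rightarrow> nat) \<Rightarrow> (nat \<Rightarrow> real mat) \<Rightarrow> nat \<Rightarrow> nat \<Rightarrow> nat" where
  "word_count l L n m = card (words l L n m)"

definition nsft_space :: "(nat \<Rightarrow> nat) \<Rightarrow> (nat \<Rightarrow> real mat) \<Rightarrow> nat \<Rightarrow> (nat \<Rightarrow> nat) set" where
  "nsft_space l L k =
     {x \<in> (\<Pi>\<^sub>E i\<in>{k..}. {1..l i}). \<forall>i\<ge>k. symb_entry (L i) (x i) (x (Suc i)) = 1}"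

definition nsft_dist ::
    "(nat \<Rightarrow> nat) \<Rightarrow> (nat \<Rightarrow> real mat) \<Rightarrow> nat \<Rightarrow> (nat \<Rightarrow> nat) \<Rightarrow> (nat \<Rightarrow> nat) \<Rightarrow> real" where
  "nsft_dist l L k x y =
     (if x = y then 0
      else if x k \<noteq> y k then 1
      else inverse (real (word_count l L k (Max {r. r \<ge> k \<and> (\<forall>i\<in>{k..r}. x i = y i)}))))"

definition nsft_shift :: "nat \<Rightarrow> (nat \<Rightarrow> nat) \<Rightarrow> (nat \<Rightarrow> nat)" where
  "nsft_shift k x = restrict x {Suc k..}"

text \<open>The product \<open>L k * L (k + 1) * \<dots> * L (n - 1)\<close>, for \<open>n > k\<close>.\<close>

definition mat_seq_prod :: "(nat \<Rightarrow> real mat) \<Rightarrow> nat \<Rightarrow> nat \<Rightarrow> real mat" where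
  "mat_seq_prod L k n = foldl (*) (L k) (map L [Suc k..<n])"

definition entry_norm :: "real mat \<Rightarrow> real" where
  "entry_norm A = (\<Sum>i<dim_row A. \<Sum>j<dim_col A. \<bar>A $$ (i, j)\<bar>)"

definition reduced_seq :: "(nat \<Rightarrow> nat) \<Rightarrow> (nat \<Rightarrow> real mat) \<Rightarrow> bool" where
  "reduced_seq l L \<longleftrightarrow>
     (\<forall>i. (\<forall>a<l i. row (L i) a \<noteq> 0\<^sub>v (l (Suc i))) \<and> (\<forall>b<l (Suc i). col (L i) b \<noteq> 0\<^sub>v (l i)))"


text \<open>
  Under the standing assumptions the \<open>nsft_dist\<close> are indeed metrics and the shifts map each space
  into the next one.
\<close>

lemma nsft_shift_in_space:
  assumes "x \<in> nsft_space l L k"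
  shows "nsft_shift k x \<in> nsft_space l L (Suc k)"
  using assms by (auto simp: nsft_space_def nsft_shift_def PiE_iff)

lemma finite_words: "finite (words l L n m)"
  by (rule finite_subset[of _ "\<Pi>\<^sub>E i\<in>{n..m}. {1..l i}"]) (auto simp: words_def intro!: finite_PiE)

lemma words_extend:
  assumes dim: "\<And>i. L i \<in> carrier_mat (l i) (l (Suc i))"
    and zero_one: "\<And>i. elements_mat (L i) \<subseteq> {0, 1}"
    and red: "reduced_seq l L" and "k \<le> m" and x: "x \<in> words l L k m"
  shows "\<exists>y\<in>words l L k (Suc m). restrict y {k..m} = x"
proof -
  have xm: "x m \<in> {1..l m}" using x \<open>k \<le> m\<close> by (auto simp: words_def PiE_iff)
  define a where "a = x m - 1"
  have a: "a < l m" using xm by (auto simp: a_def)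
  then have "row (L m) a \<noteq> 0\<^sub>v (l (Suc m))" using red by (auto simp: reduced_seq_def)
  then obtain b where b: "b < l (Suc m)" "L m $$ (a, b) \<noteq> 0"
    using dim[of m] a by (metis carrier_matD eq_vecI index_row(1) index_row(2) index_zero_vec)
  have "L m $$ (a, b) \<in> elements_mat (L m)"
    using dim[of m] a b by (metis carrier_matD elements_matI)
  then have e: "L m $$ (a, b) = 1" using zero_one[of m] b by auto
  let ?y = "x(Suc m := Suc b)"
  have "symb_entry (L i) (?y i) (?y (Suc i)) = 1" if "i \<in> {k..<Suc m}" for i
    using that x e by (cases "i = m") (auto simp: words_def symb_entry_def a_def)
  moreover have "?y \<in> (\<Pi>\<^sub>E i\<in>{k..Suc m}. {1..l i})"
    using x b \<open>k \<le> m\<close> by (auto simp: words_def PiE_iff extensional_def)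
  moreover have "restrict ?y {k..m} = x"
    using x by (auto simp: words_def PiE_iff extensional_def fun_eq_iff)
  ultimately show ?thesis unfolding words_def by blast
qed

lemma word_count_mono:
  assumes dim: "\<And>i. L i \<in> carrier_mat (l i) (l (Suc i))"
    and zero_one: "\<And>i. elements_mat (L i) \<subseteq> {0, 1}"
    and red: "reduced_seq l L" and km: "k \<le> m" and "m \<le> m'"
  shows "word_count l L k m \<le> word_count l L k m'"
  using \<open>m \<le> m'\<close>
proof (induction m' rule: dec_induct)
  case (step j)
  have "words l L k j \<subseteq> (\<lambda>y. restrict y {k..j}) ` words l L k (Suc j)"
    using words_extend[OF dim zero_one red, of k j] km step(1) by (force simp: image_iff)
  then have "word_count l L k j \<le> word_count l L k (Suc j)"
    unfolding word_count_def by (rule surj_card_le[OF finite_words])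
  with step show ?case by simp
qed simp

lemma word_count_pos:
  assumes "x \<in> nsft_space l L k" "k \<le> m"
  shows "word_count l L k m > 0"
proof -
  have "restrict x {k..m} \<in> words l L k m"
    using assms by (auto simp: nsft_space_def words_def PiE_iff)
  then show ?thesis
    unfolding word_count_def using finite_words card_gt_0_iff by blast
qed

lemma nsft_agree_Max:
  assumes "x \<in> nsft_space l L k" "y \<in> nsft_space l L k" "x \<noteq> y" "x k = y k"
  defines "A \<equiv> {r. r \<ge> k \<and> (\<forall>i\<in>{k..r}. x i = y i)}"
  shows "finite A" "Max A \<in> A" "\<And>r. r \<in> A \<longleftrightarrow> k \<le> r \<and> r \<le> Max A"
proof -
  obtain j where j: "x j \<noteq> y j" using \<open>x \<noteq> y\<close> by blast
  have "j \<ge> k"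
    using j assms(1,2) by (force simp: nsft_space_def PiE_iff extensional_def)
  then have "A \<subseteq> {..j}" using j by (force simp: A_def)
  then show fin: "finite A" using finite_subset by blast
  have "k \<in> A" using assms(4) by (auto simp: A_def)
  then show M: "Max A \<in> A" using fin Max_in by blast
  show "r \<in> A \<longleftrightarrow> k \<le> r \<and> r \<le> Max A" for r
  proof
    show "r \<in> A \<Longrightarrow> k \<le> r \<and> r \<le> Max A" using Max_ge[OF fin] by (simp add: A_def)
    have down: "r \<in> A" if "k \<le> r" "r \<le> s" "s \<in> A" for s
      using that by (simp add: A_def)
    show "k \<le> r \<and> r \<le> Max A \<Longrightarrow> r \<in> A" using down M by blast
  qed
qed

lemma Metric_space_nsft:
  assumes dim: "\<And>i. L i \<in> carrier_mat (l i) (l (Suc i))"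
    and zero_one: "\<And>i. elements_mat (L i) \<subseteq> {0, 1}"
    and red: "reduced_seq l L"
  shows "Metric_space (nsft_space l L k) (nsft_dist l L k)"
proof
  let ?A = "\<lambda>x y. {r. r \<ge> k \<and> (\<forall>i\<in>{k..r}. x i = y i)}"
  show "0 \<le> nsft_dist l L k x y" for x y by (auto simp: nsft_dist_def)
  show "nsft_dist l L k x y = nsft_dist l L k y x" for x y
  proof -
    have "?A x y = ?A y x" by auto
    then show ?thesis unfolding nsft_dist_def by (simp only: eq_commute[of x y] eq_commute[of "x k" "y k"])
  qed
  show "(nsft_dist l L k x y = 0) = (x = y)"
    if "x \<in> nsft_space l L k" "y \<in> nsft_space l L k" for x y
  proof (cases "x = y \<or> x k \<noteq> y k")
    case False
    then have ne: "x \<noteq> y" "x k = y k" by blast+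
    have "k \<le> Max (?A x y)" using nsft_agree_Max(2)[OF that ne] by blast
    then have "word_count l L k (Max (?A x y)) > 0" by (rule word_count_pos[OF that(1)])
    with ne show ?thesis by (simp only: nsft_dist_def) simp
  qed (auto simp: nsft_dist_def)
  have le1: "nsft_dist l L k x y \<le> 1" for x y :: "nat \<Rightarrow> nat"
  proof -
    have "inverse (real n) \<le> 1" for n :: nat
      by (cases n) (auto simp: field_simps)
    then show ?thesis by (simp add: nsft_dist_def)
  qed
  show "nsft_dist l L k x z \<le> nsft_dist l L k x y + nsft_dist l L k y z"
    if x: "x \<in> nsft_space l L k" and y: "y \<in> nsft_space l L k" and z: "z \<in> nsft_space l L k"
    for x y z
  proof (cases "x = y \<or> y = z \<or> x = z \<or> x k \<noteq> y k \<or> y k \<noteq> z k")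
    case True
    have nn: "0 \<le> nsft_dist l L k u v" for u v by (auto simp: nsft_dist_def)
    have dist_refl: "nsft_dist l L k u u = 0" for u by (simp add: nsft_dist_def)
    have dist_neq: "nsft_dist l L k u v = 1" if "u k \<noteq> v k" for u v
      using that by (auto simp: nsft_dist_def)
    from True show ?thesis
      using le1[of x z] nn[of x y] nn[of y z]
      by (elim disjE) (simp_all add: dist_neq dist_refl)
  next
    case False
    let ?m = "\<lambda>x y. Max (?A x y)"
    have ne: "x \<noteq> y" "y \<noteq> z" "x k = y k" "y k = z k" using False by blast+
    note mxy = nsft_agree_Max(2)[OF x y ne(1,3)] and myz = nsft_agree_Max(2)[OF y z ne(2,4)]
    have *: "min a b \<in> ?A x z" if "a \<in> ?A x y" "b \<in> ?A y z" for a b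
      using that by auto
    have xz: "x \<noteq> z" "x k = z k" using False by simp_all
    have le: "min (?m x y) (?m y z) \<le> ?m x z"
      using nsft_agree_Max(3)[OF x z xz] *[OF mxy myz] by blast
    have d: "nsft_dist l L k u v = inverse (real (word_count l L k (?m u v)))"
      if "u \<noteq> v" "u k = v k" for u v
      unfolding nsft_dist_def using that by (simp only: if_False simp_thms)
    have mono: "inverse (real (word_count l L k b)) \<le> inverse (real (word_count l L k a))"
      if "k \<le> a" "a \<le> b" for a b
      using word_count_mono[OF dim zero_one red that] word_count_pos[OF x that(1)] by simp
    have ge: "k \<le> ?m x y" "k \<le> ?m y z" using mxy myz by blast+
    have "nsft_dist l L k x z \<le> nsft_dist l L k x y \<or> nsft_dist l L k x z \<le> nsft_dist l L k y z"
    proof (cases "?m x y \<le> ?m x z")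
      case True
      show ?thesis unfolding d[OF xz] d[OF ne(1,3)] using mono[OF ge(1) True] by (rule disjI1)
    next
      case False2: False
      then have "?m y z \<le> ?m x z" using le by linarith
      from mono[OF ge(2) this] show ?thesis unfolding d[OF xz] d[OF ne(2,4)] by (rule disjI2)
    qed
    moreover have "0 \<le> nsft_dist l L k x y" "0 \<le> nsft_dist l L k y z"
      by (auto simp: nsft_dist_def)
    ultimately show ?thesis by linarith
  qed
qed

end

theory Submission
  imports Defs "HOL-Real_Asymp.Real_Asymp"
begin

text \<open>
  The cover by the sets of sequences with prescribed
  first symbol has Lebesgue number \<open>1\<close>, and the join of its pullbacks separates all words, which gives
  the lower bound. For the upper bound let \<open>C > 1 / \<delta>\<close>, where \<open>\<delta>\<close> is a common Lebesgue number. Words starting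
  at time \<open>n\<close> need not multiply at any uniform rate, so no fixed number of additional symbols
  guarantees closeness. Instead, let \<open>m \<ge> n\<close> be minimal with \<open>w(n,m) > C\<close>. As \<open>w(i,m) \<ge> w(n,m)\<close> for \<open>i \<le> n\<close>,
  sequences agreeing up to time \<open>m\<close> stay \<open>\<delta>\<close>-close up to time \<open>n\<close>; and by minimality
  \<open>w(0,m) \<le> w(0,n) w(n,m)\<close> exceeds \<open>w(0,n)\<close> at most by a constant factor. If there is no such \<open>m\<close>, the
  space itself has at most \<open>C w(0,n)\<close> points.
\<close>

section \<open>Growth rates and minimal subcovers\<close>

text \<open>A constant factor adds only a multiple of \<open>1 / n\<close> to the growth rate, which
  vanishes in the limit.\<close>

lemma limsup_ln_le_of_le_mult:
  fixes a b :: "nat \<Rightarrow> nat" and K :: nat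
  assumes le: "\<And>n. n > 0 \<Longrightarrow> a n \<le> K * b n"
  shows "limsup (\<lambda>n. ereal (1 / real n * ln (real (a n))))
           \<le> limsup (\<lambda>n. ereal (1 / real n * ln (real (b n))))"
proof -
  \<comment> \<open>Passing from \<open>K\<close> to \<open>Suc K\<close> makes the factor positive
    and \<open>?c\<close> nonnegative, even for \<open>K = 0\<close>.\<close>
  let ?c = "ln (real (Suc K))"
  have ln_le: "ln (real (a n)) \<le> ?c + ln (real (b n))" if "n > 0" for n
  proof (cases "a n = 0")
    case False
    with le[OF that] have b: "b n > 0" by (cases "b n") auto
    have "a n \<le> Suc K * b n" using le[OF that] by simp
    then have "real (a n) \<le> real (Suc K) * real (b n)" by (metis of_nat_le_iff of_nat_mult)
    then have "ln (real (a n)) \<le> ln (real (Suc K) * real (b n))"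
      using False b by (subst ln_le_cancel_iff) auto
    also have "\<dots> = ?c + ln (real (b n))" using b by (simp add: ln_mult)
    finally show ?thesis .
  next
    \<comment> \<open>Since \<open>ln 0 = 0\<close>, the left side is zero, and both summands on the
      right are nonnegative, also when \<open>b n = 0\<close>.\<close>
    case True
    moreover have "ln (real (b n)) \<ge> 0" by (cases "b n") auto
    ultimately show ?thesis by simp
  qed
  have "(\<lambda>n. ?c / real n) \<longlonglongrightarrow> 0" by real_asymp
  then have lim: "(\<lambda>n. ereal (1 / real n * ?c)) \<longlonglongrightarrow> 0" 
    by (simp add: zero_ereal_def)
  have "limsup (\<lambda>n. ereal (1 / real n * ln (real (a n))))
      \<le> limsup (\<lambda>n. ereal (1 / real n * ?c) + ereal (1 / real n * ln (real (b n))))"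
  proof (rule Limsup_mono, rule eventually_sequentiallyI[of 1])
    fix n :: nat assume "1 \<le> n"
    then have "1 / real n * ln (real (a n)) \<le> 1 / real n * (?c + ln (real (b n)))"
      by (intro mult_left_mono ln_le) auto
    then show "ereal (1 / real n * ln (real (a n)))
        \<le> ereal (1 / real n * ?c) + ereal (1 / real n * ln (real (b n)))"
      by (simp only: plus_ereal.simps ereal_less_eq distrib_left)
  qed
  also have "\<dots> = 0 + limsup (\<lambda>n. ereal (1 / real n * ln (real (b n))))"
    by (rule ereal_limsup_lim_add[OF lim]) simp
  finally show ?thesis by simp
qed

lemma min_subcover_le:
  assumes "\<V> \<subseteq> \<U>" "finite \<V>" "\<Union>\<V> = Y"
  shows "min_subcover Y \<U> \<le> card \<V>"
  unfolding min_subcover_def by (rule cInf_lower) (use assms in auto)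

text \<open>An infimum of natural numbers is attained if the set is nonempty; the witness
  \<open>\<V>0\<close> supplies the finite subcover that compactness would give.\<close>

lemma min_subcover_attained:
  assumes "\<V>0 \<subseteq> \<U>" "finite \<V>0" "\<Union>\<V>0 = Y"
  obtains \<V> where "\<V> \<subseteq> \<U>" "finite \<V>" "\<Union>\<V> = Y" "card \<V> = min_subcover Y \<U>"
proof -
  have "{card \<V> | \<V>. \<V> \<subseteq> \<U> \<and> finite \<V> \<and> \<Union>\<V> = Y} \<noteq> {}" using assms by blast
  then have "min_subcover Y \<U> \<in> {card \<V> | \<V>. \<V> \<subseteq> \<U> \<and> finite \<V> \<and> \<Union>\<V> = Y}"
    unfolding min_subcover_def by (rule Inf_nat_def1)
  then show ?thesis using that by auto
qed

section \<open>Sequences, words and distances\<close>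

lemma fiter_nsft_shift: "x \<in> nsft_space l L 0 \<Longrightarrow> fiter nsft_shift n x = restrict x {n..}"
proof (induction n)
  case 0
  then show ?case by (auto simp: nsft_space_def PiE_iff fun_eq_iff)
next
  case (Suc n)
  then show ?case by (auto simp: nsft_shift_def fun_eq_iff)
qed

lemma restrict_nsft_space:
  "x \<in> nsft_space l L k \<Longrightarrow> k \<le> n \<Longrightarrow> restrict x {n..} \<in> nsft_space l L n"
  by (auto simp: nsft_space_def)

lemma restrict_words: "x \<in> nsft_space l L k \<Longrightarrow> restrict x {k..m} \<in> words l L k m"
  by (auto simp: nsft_space_def words_def)

lemma words_eqI:
  assumes "x \<in> words l L k m" "y \<in> words l L k m" "\<And>i. i \<in> {k..m} \<Longrightarrow> x i = y i"
  shows "x = y"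
proof (rule PiE_ext[of x "{k..m}" "\<lambda>i. {1..l i}"])
qed (use assms in \<open>simp_all add: words_def\<close>)

lemma nsft_space_neq_index:
  assumes "x \<in> nsft_space l L k" "y \<in> nsft_space l L k" "x j \<noteq> y j"
  shows "k \<le> j"
proof (rule ccontr)
  assume "\<not> k \<le> j"
  then have "x j = undefined" "y j = undefined"
    using assms(1,2) by (auto simp: nsft_space_def PiE_iff extensional_def)
  then show False using assms(3) by simp
qed

lemma nsft_dist_less_one:
  assumes "nsft_dist l L k x y < 1"
  shows "x k = y k"
  using assms by (auto simp: nsft_dist_def split: if_splits)

text \<open>The last index of agreement is at least \<open>m\<close>, and word counts increase with
  the right end point.\<close>

lemma nsft_dist_le:
  assumes dim: "\<And>i. L i \<in> carrier_mat (l i) (l (Suc i))"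
    and zero_one: "\<And>i. elements_mat (L i) \<subseteq> {0, 1}"
    and red: "reduced_seq l L"
    and x: "x \<in> nsft_space l L k" and y: "y \<in> nsft_space l L k" and "k \<le> m"
    and agree: "\<And>i. k \<le> i \<Longrightarrow> i \<le> m \<Longrightarrow> x i = y i"
  shows "nsft_dist l L k x y \<le> inverse (real (word_count l L k m))"
proof (cases "x = y")
  case True
  then show ?thesis by (simp add: nsft_dist_def)
next
  case False
  let ?M = "Max {r. r \<ge> k \<and> (\<forall>i\<in>{k..r}. x i = y i)}"
  have xk: "x k = y k" using agree \<open>k \<le> m\<close> by simp
  have "m \<le> ?M"
    using nsft_agree_Max(3)[OF x y False xk, of m] agree \<open>k \<le> m\<close> by simp
  then have "word_count l L k m \<le> word_count l L k ?M"
    by (rule word_count_mono[OF dim zero_one red \<open>k \<le> m\<close>])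
  moreover have "word_count l L k m > 0" using word_count_pos[OF x \<open>k \<le> m\<close>] .
  moreover have "nsft_dist l L k x y = inverse (real (word_count l L k ?M))"
    unfolding nsft_dist_def using False xk by (simp only: if_False simp_thms)
  ultimately show ?thesis by simp
qed

text \<open>Cutting at \<open>p\<close> is injective; both pieces keep the symbol at
  \<open>p\<close>.\<close>

lemma word_count_submult:
  assumes "k \<le> p" "p \<le> m"
  shows "word_count l L k m \<le> word_count l L k p * word_count l L p m"
proof -
  let ?f = "\<lambda>x. (restrict x {k..p}, restrict x {p..m})"
  have "inj_on ?f (words l L k m)"
  proof (rule inj_onI)
    fix x y assume xy: "x \<in> words l L k m" "y \<in> words l L k m" and eq: "?f x = ?f y"
    have "x i = y i" if "i \<in> {k..m}" for i
    proof (cases "i \<le> p")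
      case True
      then show ?thesis using eq that by (auto simp: fun_eq_iff restrict_def dest: spec[of _ i])
    next
      case False
      then show ?thesis using eq that by (auto simp: fun_eq_iff restrict_def dest: spec[of _ i])
    qed
    then show "x = y" by (rule words_eqI[OF xy])
  qed
  moreover have "?f ` words l L k m \<subseteq> words l L k p \<times> words l L p m"
    using assms by (auto simp: words_def PiE_iff)
  ultimately have "card (words l L k m) \<le> card (words l L k p \<times> words l L p m)"
    using finite_words by (intro card_inj_on_le[of ?f]) auto
  then show ?thesis by (simp add: word_count_def card_cartesian_product)
qed

lemma word_count_le_power:
  assumes "\<And>i. l i \<le> B"
  shows "word_count l L k m \<le> B ^ (Suc m - k)"
proof -
  have "word_count l L k m \<le> card (\<Pi>\<^sub>E i\<in>{k..m}. {1..l i})"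
    unfolding word_count_def words_def by (rule card_mono) (auto intro: finite_PiE)
  also have "\<dots> = (\<Prod>i\<in>{k..m}. l i)" by (simp add: card_PiE)
  also have "\<dots> \<le> (\<Prod>i\<in>{k..m}. B)" using assms by (intro prod_mono) auto
  finally show ?thesis by simp
qed

section \<open>Reduced sequences: extending words to the right and to the left\<close>

locale nsft =
  fixes l :: "nat \<Rightarrow> nat" and L :: "nat \<Rightarrow> real mat"
  assumes dim: "\<And>i. L i \<in> carrier_mat (l i) (l (Suc i))"
    and zero_one: "\<And>i. elements_mat (L i) \<subseteq> {0, 1}"
    and reduced: "reduced_seq l L"
begin

abbreviation "X \<equiv> nsft_space l L"
abbreviation "d \<equiv> nsft_dist l L"
abbreviation "w \<equiv> word_count l L"

lemma entry_cases: "a < l i \<Longrightarrow> b < l (Suc i) \<Longrightarrow> L i $$ (a, b) = 0 \<or> L i $$ (a, b) = 1"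
  using dim[of i] zero_one[of i] elements_matI[of "L i" _ _ a b] by blast

lemma ex_successor:
  assumes "a \<in> {1..l i}"
  shows "\<exists>b\<in>{1..l (Suc i)}. symb_entry (L i) a b = 1"
proof -
  have a: "a - 1 < l i" using assms by auto
  then have "row (L i) (a - 1) \<noteq> 0\<^sub>v (l (Suc i))" using reduced by (auto simp: reduced_seq_def)
  then obtain b where "b < l (Suc i)" "L i $$ (a - 1, b) \<noteq> 0"
    using dim[of i] a by (metis carrier_matD eq_vecI index_row(1) index_row(2) index_zero_vec)
  \<comment> \<open>\<open>Suc b\<close> turns the matrix index back into a symbol.\<close>
  with entry_cases[OF a this(1)] show ?thesis
    by (intro bexI[of _ "Suc b"]) (auto simp: symb_entry_def)
qed

lemma ex_predecessor:
  assumes "b \<in> {1..l (Suc i)}"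
  shows "\<exists>a\<in>{1..l i}. symb_entry (L i) a b = 1"
proof -
  have b: "b - 1 < l (Suc i)" using assms by auto
  then have "col (L i) (b - 1) \<noteq> 0\<^sub>v (l i)" using reduced by (auto simp: reduced_seq_def)
  then obtain a where "a < l i" "L i $$ (a, b - 1) \<noteq> 0"
    using dim[of i] b by (metis carrier_matD eq_vecI index_col dim_col index_zero_vec)
  with entry_cases[OF this(1) b] show ?thesis
    by (intro bexI[of _ "Suc a"]) (auto simp: symb_entry_def)
qed

text \<open>Nonzero rows provide a successor for every symbol; iterating one fixed choice from the
  last symbol of the word produces the tail.\<close>

lemma words_extend_infinite:
  assumes "k \<le> m" and x: "x \<in> words l L k m"
  shows "\<exists>y\<in>X k. restrict y {k..m} = x"
proof -
  define g where "g i a = (SOME b. b \<in> {1..l (Suc i)} \<and> symb_entry (L i) a b = 1)" for i a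
  have g: "g i a \<in> {1..l (Suc i)}" "symb_entry (L i) a (g i a) = 1" if "a \<in> {1..l i}" for i a
    using someI_ex[OF ex_successor[OF that, unfolded Bex_def]] unfolding g_def by blast+
  \<comment> \<open>\<open>z j\<close> is the symbol at absolute position \<open>m + j\<close>,
    starting with the last symbol of the given word.\<close>
  define z where "z = rec_nat (x m) (\<lambda>j. g (m + j))"
  have z_simps: "z 0 = x m" "z (Suc j) = g (m + j) (z j)" for j by (simp_all add: z_def)
  have "x m \<in> {1..l m}" using x \<open>k \<le> m\<close> by (auto simp: words_def PiE_iff)
  then have z: "z j \<in> {1..l (m + j)}" for j
    by (induction j) (simp_all only: z_simps g(1) add_0_right add_Suc_right)
  \<comment> \<open>Below \<open>k\<close> this takes over the value \<open>undefined\<close> of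
    \<open>x\<close>, so \<open>y\<close> is extensional on \<open>{k..}\<close>.\<close>
  define y where "y j = (if j \<le> m then x j else z (j - m))" for j
  have "symb_entry (L i) (y i) (y (Suc i)) = 1" if "k \<le> i" for i
  proof (cases "i < m")
    case True
    then show ?thesis using x that by (auto simp: y_def words_def)
  next
    case False
    then have "y i = z (i - m)" "y (Suc i) = g i (z (i - m))"
      by (auto simp: y_def z_simps Suc_diff_le)
    then show ?thesis using g(2)[of "z (i - m)" i] z[of "i - m"] False by simp
  qed
  moreover have "y \<in> (\<Pi>\<^sub>E i\<in>{k..}. {1..l i})"
  proof (rule PiE_I)
    show "y i \<in> {1..l i}" if "i \<in> {k..}" for i
      using that x z[of "i - m"] by (auto simp: y_def words_def PiE_iff)
    show "y i = undefined" if "i \<notin> {k..}" for i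
      using that x \<open>k \<le> m\<close> by (auto simp: y_def words_def PiE_iff extensional_def)
  qed
  moreover have "restrict y {k..m} = x"
    using x by (auto simp: y_def words_def PiE_iff extensional_def fun_eq_iff)
  ultimately show ?thesis unfolding nsft_space_def by blast
qed

text \<open>Nonzero columns let every word be prolonged by one symbol on the left, so forgetting the
  first symbol is surjective.\<close>

lemma word_count_Suc_left_le:
  assumes "k < m"
  shows "w (Suc k) m \<le> w k m"
proof -
  have "words l L (Suc k) m \<subseteq> (\<lambda>y. restrict y {Suc k..m}) ` words l L k m"
  proof
    fix x assume x: "x \<in> words l L (Suc k) m"
    have "x (Suc k) \<in> {1..l (Suc k)}" using x assms by (auto simp: words_def PiE_iff)
    then obtain a where a: "a \<in> {1..l k}" "symb_entry (L k) a (x (Suc k)) = 1"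
      using ex_predecessor by blast
    let ?y = "x(k := a)"
    have "symb_entry (L i) (?y i) (?y (Suc i)) = 1" if "i \<in> {k..<m}" for i
      using that x a by (cases "i = k") (auto simp: words_def)
    moreover have "?y \<in> (\<Pi>\<^sub>E i\<in>{k..m}. {1..l i})"
      using x a assms by (auto simp: words_def PiE_iff extensional_def)
    ultimately have "?y \<in> words l L k m" unfolding words_def by blast
    moreover have "x = restrict ?y {Suc k..m}"
      using x by (auto simp: words_def PiE_iff extensional_def fun_eq_iff)
    ultimately show "x \<in> (\<lambda>y. restrict y {Suc k..m}) ` words l L k m" by blast
  qed
  then show ?thesis unfolding word_count_def by (rule surj_card_le[OF finite_words])
qed

text \<open>Because of this, a single end point \<open>m\<close> chosen for time \<open>n\<close>
  controls the distances at all earlier times.\<close>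

lemma word_count_antimono_left:
  assumes "i \<le> j" "j \<le> m"
  shows "w j m \<le> w i m"
  using assms(1)
proof (induction i rule: inc_induct)
  case (step i)
  with word_count_Suc_left_le[of i m] assms show ?case by simp
qed simp

section \<open>Upper bound: spanning sets and small subcovers\<close>

text \<open>Finitely many distinct sequences are already distinguished by a long enough initial
  word, so no finite subset can exceed the bound on the word counts.\<close>

lemma card_nsft_space_le:
  assumes bound: "\<And>m. m \<ge> n \<Longrightarrow> w k m \<le> K"
  shows "finite (X k)" "card (X k) \<le> K"
proof -
  have "card S \<le> K" if S: "S \<subseteq> X k" "finite S" for S
  proof -
    define f :: "(nat \<Rightarrow> nat) \<Rightarrow> (nat \<Rightarrow> nat) \<Rightarrow> nat" where "f x y = (SOME j. x j \<noteq> y j)" for x y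
    have f: "x (f x y) \<noteq> y (f x y)" if "x \<noteq> y" for x y
      using that someI_ex[of "\<lambda>j. x j \<noteq> y j"] unfolding f_def by (auto simp: fun_eq_iff)
    have "finite ((\<lambda>(x, y). f x y) ` (S \<times> S))" using S by simp
    \<comment> \<open>\<open>m0\<close> bounds the chosen positions of disagreement for all pairs
      from \<open>S\<close> at once.\<close>
    then obtain m0 where m0: "\<And>x y. x \<in> S \<Longrightarrow> y \<in> S \<Longrightarrow> f x y \<le> m0"
      by (auto simp: finite_nat_set_iff_bounded_le)
    define m where "m = max n m0"
    have "inj_on (\<lambda>x. restrict x {k..m}) S"
    proof (rule inj_onI, rule ccontr)
      fix x y assume xy: "x \<in> S" "y \<in> S" "restrict x {k..m} = restrict y {k..m}" "x \<noteq> y"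
      have "f x y \<le> m" using m0[OF xy(1,2)] by (simp add: m_def)
      moreover have "f x y \<ge> k"
        using nsft_space_neq_index[of x l L k y "f x y"] f[OF xy(4)] xy(1,2) S(1) by blast
      ultimately have "x (f x y) = y (f x y)"
        using fun_cong[OF xy(3), of "f x y"] by simp
      then show False using f[OF xy(4)] by simp
    qed
    moreover have "(\<lambda>x. restrict x {k..m}) ` S \<subseteq> words l L k m"
      using S restrict_words by blast
    ultimately have "card S \<le> w k m"
      unfolding word_count_def using finite_words by (intro card_inj_on_le) auto
    also have "\<dots> \<le> K" by (rule bound) (simp add: m_def)
    finally show ?thesis .
  qed
  then have "\<And>S. finite S \<Longrightarrow> S \<subseteq> X k \<Longrightarrow> card S \<le> K" by blast
  then show "finite (X k)" "card (X k) \<le> K"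
    using finite_if_finite_subsets_card_bdd[of "X k" K] by blast+
qed

text \<open>The factor \<open>C * B\<^sup>2\<close> does not depend on \<open>n\<close>:
  \<open>C\<close> bounds the word count just before it passes the threshold, and
  \<open>B\<^sup>2\<close> the effect of the step that crosses it.\<close>

lemma ex_spanning_set:
  assumes B: "\<And>i. l i \<le> B" and "B \<ge> 1" and \<delta>: "inverse (real (Suc C)) < \<delta>" "C \<ge> 1"
  obtains F where "F \<subseteq> X 0" "finite F" "card F \<le> C * B\<^sup>2 * w 0 n"
    "\<And>x. x \<in> X 0 \<Longrightarrow> \<exists>y\<in>F. \<forall>i\<le>n. d i (restrict x {i..}) (restrict y {i..}) < \<delta>"
proof -
  have "\<delta> > 0" using \<delta>(1) by (rule le_less_trans[rotated]) simp
  show ?thesis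
  proof (cases "\<exists>m\<ge>n. w n m > C")
    case True
    define m where "m = (LEAST m. m \<ge> n \<and> w n m > C)"
    have m: "m \<ge> n" "w n m > C" using LeastI_ex[OF True] by (auto simp: m_def)
    have "w n m \<le> C * B\<^sup>2"
    proof (cases "m = n")
      case True
      \<comment> \<open>The threshold is passed at once; a word on \<open>{n..n}\<close> is a single
        symbol.\<close>
      have "w n m \<le> B" using word_count_le_power[of l B L n n] B True by simp
      also have "\<dots> \<le> C * B\<^sup>2" using assms(2) \<delta>(2) by (simp add: power2_eq_square)
      finally show ?thesis .
    next
      case False
      then obtain p where p: "m = Suc p" "p \<ge> n" using m(1) by (cases m) auto
      \<comment> \<open>Minimality of \<open>m\<close>, applied to its predecessor \<open>p\<close>;
        words on \<open>{p..m}\<close> have two symbols, whence the square below.\<close>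
      have "\<not> (p \<ge> n \<and> w n p > C)" using p(1) unfolding m_def by (intro not_less_Least) simp
      then have "w n p \<le> C" using p(2) by simp
      have "w n m \<le> w n p * w p m" using p by (intro word_count_submult) auto
      also have "\<dots> \<le> C * B\<^sup>2"
        using \<open>w n p \<le> C\<close> word_count_le_power[of l B L p m] B p(1) by (intro mult_mono) auto
      finally show ?thesis .
    qed
    \<comment> \<open>The spanning set consists of one point \<open>e u\<close> for each word
      \<open>u\<close> on \<open>{0..m}\<close>.\<close>
    obtain e where e: "e u \<in> X 0" "restrict (e u) {0..m} = u" if "u \<in> words l L 0 m" for u
      using words_extend_infinite[of 0 m] by (metis le0)
    show ?thesis
    proof (rule that[of "e ` words l L 0 m"])
      show "e ` words l L 0 m \<subseteq> X 0" using e by blast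
      show "finite (e ` words l L 0 m)" using finite_words by blast
      have "card (e ` words l L 0 m) \<le> w 0 m"
        unfolding word_count_def by (rule card_image_le[OF finite_words])
      also have "\<dots> \<le> w 0 n * w n m" using m(1) by (intro word_count_submult) auto
      also have "\<dots> \<le> w 0 n * (C * B\<^sup>2)" using \<open>w n m \<le> C * B\<^sup>2\<close> by (rule mult_le_mono2)
      finally show "card (e ` words l L 0 m) \<le> C * B\<^sup>2 * w 0 n" by (simp add: mult.commute)
      fix x assume x: "x \<in> X 0"
      let ?u = "restrict x {0..m}"
      have u: "?u \<in> words l L 0 m" using x by (rule restrict_words)
      show "\<exists>y\<in>e ` words l L 0 m. \<forall>i\<le>n. d i (restrict x {i..}) (restrict y {i..}) < \<delta>"
      proof (rule bexI[OF _ imageI[OF u]], intro allI impI)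
        fix i assume "i \<le> n"
        have agree: "x j = e ?u j" if "j \<le> m" for j
          using fun_cong[OF e(2)[OF u], of j] that by simp
        have "d i (restrict x {i..}) (restrict (e ?u) {i..}) \<le> inverse (real (w i m))"
          using \<open>i \<le> n\<close> m(1) agree
          by (intro nsft_dist_le dim zero_one reduced restrict_nsft_space[OF x]
              restrict_nsft_space[OF e(1)[OF u]]) auto
        \<comment> \<open>\<open>w i m \<ge> w n m \<ge> Suc C\<close>.\<close>
        also have "\<dots> \<le> inverse (real (Suc C))"
          using word_count_antimono_left[OF \<open>i \<le> n\<close> m(1)] m(2) by (intro le_imp_inverse_le) auto
        finally show "d i (restrict x {i..}) (restrict (e ?u) {i..}) < \<delta>" using \<delta> by linarith
      qed
    qed
  next
    case False
    \<comment> \<open>All word counts from time \<open>n\<close> on stay below \<open>C\<close>, so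
      \<open>X 0\<close> is finite and can serve as its own spanning set.\<close>
    have "w 0 m \<le> C * w 0 n" if "m \<ge> n" for m
    proof -
      have "w 0 m \<le> w 0 n * w n m" using that by (intro word_count_submult) auto
      also have "\<dots> \<le> w 0 n * C" using False that by (intro mult_le_mono2) (auto simp: not_less)
      finally show ?thesis by (simp add: mult.commute)
    qed
    note fin = card_nsft_space_le[of n 0, OF this]
    show ?thesis
    proof (rule that[of "X 0"])
      have "C * 1 * w 0 n \<le> C * B\<^sup>2 * w 0 n"
        using \<open>B \<ge> 1\<close> by (intro mult_le_mono order_refl) simp
      then show "card (X 0) \<le> C * B\<^sup>2 * w 0 n"
        using fin(2) unfolding mult_1_right by (rule le_trans[rotated])
    qed (use fin(1) \<open>\<delta> > 0\<close> in \<open>auto simp: nsft_dist_def\<close>)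
  qed
qed

abbreviation "orbit_join \<U> n \<equiv>
  cover_join (X 0) n (\<lambda>i. preimage_cover (X 0) (fiter nsft_shift i) (\<U> i))"

text \<open>Each point of a spanning set selects one member of the join, by choosing at each time a
  cover element that contains the \<open>\<delta>\<close>-ball around its orbit.\<close>

lemma ex_small_subcover:
  assumes B: "\<And>i. l i \<le> B" "B \<ge> 1" and \<U>: "\<U> \<in> admissible_covers X d"
  obtains K where
    "\<And>n. \<exists>\<V>\<subseteq>orbit_join \<U> n. finite \<V> \<and> \<Union>\<V> = X 0 \<and> card \<V> \<le> K * w 0 n"
proof -
  obtain \<delta> where "\<delta> > 0" and leb: "\<And>n. lebesgue_number_of (X n) (d n) (\<U> n) \<delta>"
    using \<U> by (auto simp: admissible_covers_def)
  \<comment> \<open>The spanning set is built with \<open>C = Suc c\<close>, which is at least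
    \<open>1\<close> as required there.\<close>
  obtain c where "inverse (real (Suc c)) < \<delta>" using reals_Archimedean[OF \<open>\<delta> > 0\<close>] by blast
  moreover have "inverse (real (Suc (Suc c))) \<le> inverse (real (Suc c))"
    by (intro le_imp_inverse_le) auto
  ultimately have C: "inverse (real (Suc (Suc c))) < \<delta>" by linarith
  obtain u where u: "u i x \<in> \<U> i" "Metric_space.mball (X i) (d i) x \<delta> \<subseteq> u i x"
    if "x \<in> X i" for i x
    using leb unfolding lebesgue_number_of_def by metis
  show ?thesis
  proof (rule that[of "Suc c * B\<^sup>2"])
    fix n
    obtain F where F: "F \<subseteq> X 0" "finite F" "card F \<le> Suc c * B\<^sup>2 * w 0 n"
      "\<And>x. x \<in> X 0 \<Longrightarrow> \<exists>y\<in>F. \<forall>i\<le>n. d i (restrict x {i..}) (restrict y {i..}) < \<delta>"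
      using ex_spanning_set[OF B C, of n] by auto
    define V where
      "V y = X 0 \<inter> (\<Inter>i<n. {x \<in> X 0. fiter nsft_shift i x \<in> u i (restrict y {i..})})" for y
    have "V y \<in> orbit_join \<U> n" if "y \<in> F" for y
    proof -
      have "u i (restrict y {i..}) \<in> \<U> i" for i
        using that F(1) by (intro u restrict_nsft_space[of _ l L 0]) auto
      then show ?thesis unfolding cover_join_def preimage_cover_def V_def by blast
    qed
    moreover have "\<Union>(V ` F) = X 0"
    proof
      show "X 0 \<subseteq> \<Union>(V ` F)"
      proof
        fix x assume x: "x \<in> X 0"
        then obtain y where y: "y \<in> F"
          "\<And>i. i \<le> n \<Longrightarrow> d i (restrict x {i..}) (restrict y {i..}) < \<delta>"
          using F(4) by blast
        have "restrict x {i..} \<in> u i (restrict y {i..})" if "i < n" for i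
        proof -
          interpret Metric_space "X i" "d i" by (rule Metric_space_nsft[OF dim zero_one reduced])
          have xy: "restrict x {i..} \<in> X i" "restrict y {i..} \<in> X i"
            using x y(1) F(1) by (auto intro!: restrict_nsft_space[of _ l L 0])
          then have "restrict x {i..} \<in> mball (restrict y {i..}) \<delta>"
            using y(2)[of i] that by (simp add: commute)
          then show ?thesis using u(2)[OF xy(2)] by blast
        qed
        then have "x \<in> V y" using x by (simp add: V_def fiter_nsft_shift)
        then show "x \<in> \<Union>(V ` F)" using y(1) by blast
      qed
    qed (auto simp: V_def)
    moreover have "card (V ` F) \<le> Suc c * B\<^sup>2 * w 0 n"
      using card_image_le[OF F(2)] F(3) by (rule le_trans)
    ultimately show "\<exists>\<V>\<subseteq>orbit_join \<U> n. finite \<V> \<and> \<Union>\<V> = X 0 \<and> card \<V> \<le> Suc c * B\<^sup>2 * w 0 n"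
      using F(2) by (intro exI[of _ "V ` F"]) auto
  qed
qed

section \<open>Lower bound: the cover by first symbols\<close>

definition symbol_cover :: "nat \<Rightarrow> (nat \<Rightarrow> nat) set set" where
  "symbol_cover k = (\<lambda>a. {x \<in> X k. x k = a}) ` {1..l k}"

text \<open>Sequences with different first symbols have distance \<open>1\<close>, so every unit
  ball lies in one cylinder. This yields openness and a Lebesgue number that is uniform in the
  level.\<close>

lemma symbol_cover_admissible: "symbol_cover \<in> admissible_covers X d"
proof -
  have "open_cover (X k) (d k) (symbol_cover k) \<and>
        lebesgue_number_of (X k) (d k) (symbol_cover k) 1" for k
  proof -
    interpret Metric_space "X k" "d k" by (rule Metric_space_nsft[OF dim zero_one reduced])
    have ball: "mball x 1 \<subseteq> {y \<in> X k. y k = x k}" for x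
      using nsft_dist_less_one[of l L k x] by fastforce
    have symb: "x k \<in> {1..l k}" if "x \<in> X k" for x
      using that by (auto simp: nsft_space_def PiE_iff)
    have "openin mtopology {x \<in> X k. x k = a}" for a
      unfolding openin_mtopology using ball by (auto intro!: exI[of _ 1])
    moreover have "\<exists>U\<in>symbol_cover k. mball x 1 \<subseteq> U" if "x \<in> X k" for x
      unfolding symbol_cover_def using ball[of x] symb[OF that] by blast
    moreover have "\<Union>(symbol_cover k) = X k"
      unfolding symbol_cover_def using symb by blast
    ultimately show ?thesis
      unfolding open_cover_def lebesgue_number_of_def by (auto simp: symbol_cover_def)
  qed
  then show ?thesis unfolding admissible_covers_def by (auto intro!: exI[of _ 1])
qed

text \<open>The \<open>i\<close>-th factor of the join fixes the symbol at position
  \<open>i\<close>, as shifts do not renumber coordinates.\<close>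

lemma orbit_join_symbol_cover_agree:
  assumes "Z \<in> orbit_join symbol_cover n" "x \<in> Z" "y \<in> Z" "i < n"
  shows "x i = y i"
proof -
  obtain V where V: "Z = X 0 \<inter> (\<Inter>i<n. V i)"
    "\<And>i. i < n \<Longrightarrow> V i \<in> preimage_cover (X 0) (fiter nsft_shift i) (symbol_cover i)"
    using assms(1) unfolding cover_join_def by blast
  obtain a where "V i = {x \<in> X 0. fiter nsft_shift i x \<in> {x \<in> X i. x i = a}}"
    using V(2)[OF assms(4)] unfolding preimage_cover_def symbol_cover_def by blast
  then have "z i = a" if "z \<in> Z" for z
  proof -
    have "z \<in> X 0" "z \<in> V i" using that V(1) assms(4) by blast+
    with \<open>V i = _\<close> have "restrict z {i..} i = a" by (simp add: fiter_nsft_shift)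
    then show ?thesis by simp
  qed
  then show ?thesis using assms(2,3) by metis
qed

text \<open>Extensions of distinct words lie in distinct members of the subcover. Joining
  \<open>Suc n\<close> covers fixes the symbols \<open>0\<close> to \<open>n\<close>, which is
  exactly a word counted by \<open>w 0 n\<close>.\<close>

lemma word_count_le_card_subcover:
  assumes \<V>: "\<V> \<subseteq> orbit_join symbol_cover (Suc n)" "finite \<V>" "\<Union>\<V> = X 0"
  shows "w 0 n \<le> card \<V>"
proof -
  obtain e where e: "e u \<in> X 0" "restrict (e u) {0..n} = u" if "u \<in> words l L 0 n" for u
    using words_extend_infinite[of 0 n] by (metis le0)
  have "\<forall>x\<in>X 0. \<exists>Z. Z \<in> \<V> \<and> x \<in> Z" using \<V>(3) by blast
  then obtain Z where Z: "Z x \<in> \<V>" "x \<in> Z x" if "x \<in> X 0" for x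
    unfolding bchoice_iff by blast
  have "inj_on (\<lambda>u. Z (e u)) (words l L 0 n)"
  proof (rule inj_onI)
    fix u v assume uv: "u \<in> words l L 0 n" "v \<in> words l L 0 n" "Z (e u) = Z (e v)"
    have "e u i = e v i" if "i < Suc n" for i
      using orbit_join_symbol_cover_agree[OF _ Z(2)[OF e(1)[OF uv(1)]], of "Suc n" "e v" i]
        Z[OF e(1)[OF uv(1)]] Z[OF e(1)[OF uv(2)]] uv(3) \<V>(1) that by auto
    then have "restrict (e u) {0..n} = restrict (e v) {0..n}" by (auto simp: fun_eq_iff)
    then show "u = v" using e(2) uv by metis
  qed
  then show ?thesis
    unfolding word_count_def using Z(1) e(1) \<V>(2) by (intro card_inj_on_le) auto
qed

section \<open>Entropy as growth rate of the word counts\<close>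

theorem h_top_eq_word_growth:
  assumes bdd: "\<exists>B. \<forall>i. l i \<le> B"
  shows "h_top X d nsft_shift = limsup (\<lambda>n. ereal (1 / real n * ln (real (w 0 n))))"
proof -
  obtain B0 where "\<And>i. l i \<le> B0" using bdd by blast
  then have B: "\<And>i. l i \<le> Suc B0" "Suc B0 \<ge> 1" by (auto intro: le_SucI)
  show ?thesis
  proof (rule antisym)
    show "h_top X d nsft_shift \<le> limsup (\<lambda>n. ereal (1 / real n * ln (real (w 0 n))))"
      unfolding h_top_def
    proof (rule SUP_least)
      fix \<U> assume "\<U> \<in> admissible_covers X d"
      from ex_small_subcover[OF B this] obtain K where
        K: "\<exists>\<V>\<subseteq>orbit_join \<U> n. finite \<V> \<and> \<Union>\<V> = X 0 \<and> card \<V> \<le> K * w 0 n" for n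
        by blast
      have "min_subcover (X 0) (orbit_join \<U> n) \<le> K * w 0 n" for n
      proof -
        obtain \<V> where "\<V> \<subseteq> orbit_join \<U> n" "finite \<V>" "\<Union>\<V> = X 0" "card \<V> \<le> K * w 0 n"
          using K[of n] by (elim exE conjE)
        then show ?thesis by (intro le_trans[OF min_subcover_le])
      qed
      then show "limsup (\<lambda>n. ereal (1 / real n * ln (real (min_subcover (X 0) (orbit_join \<U> n)))))
          \<le> limsup (\<lambda>n. ereal (1 / real n * ln (real (w 0 n))))"
        by (rule limsup_ln_le_of_le_mult)
    qed
  next
    \<comment> \<open>The join of \<open>n\<close> covers sees only positions \<open>0\<close> to
      \<open>n - 1\<close>; the last symbol costs at most the factor
      \<open>(Suc B0)\<^sup>2\<close>, which bounds the number of words on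
      \<open>{p..n}\<close>.\<close>
    have "w 0 n \<le> (Suc B0)\<^sup>2 * min_subcover (X 0) (orbit_join symbol_cover n)"
      if n: "n > 0" for n
    proof -
      obtain p where p: "n = Suc p" using n by (cases n) auto
      \<comment> \<open>The upper bound argument provides the finite subcover that makes the minimum
        meaningful.\<close>
      obtain \<V>0 where "\<V>0 \<subseteq> orbit_join symbol_cover n" "finite \<V>0" "\<Union>\<V>0 = X 0"
        using ex_small_subcover[OF B symbol_cover_admissible] by (metis (no_types, lifting))
      then obtain \<V> where \<V>: "\<V> \<subseteq> orbit_join symbol_cover n" "finite \<V>" "\<Union>\<V> = X 0"
        "card \<V> = min_subcover (X 0) (orbit_join symbol_cover n)"
        by (rule min_subcover_attained)
      have "w 0 p \<le> min_subcover (X 0) (orbit_join symbol_cover n)"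
        using word_count_le_card_subcover[of \<V> p] \<V> unfolding p by simp
      moreover have "w 0 n \<le> w 0 p * w p n" using p by (intro word_count_submult) auto
      moreover have "w p n \<le> (Suc B0)\<^sup>2" using word_count_le_power[of l "Suc B0" L p n] B(1) p by simp
      ultimately have "w 0 n \<le> min_subcover (X 0) (orbit_join symbol_cover n) * (Suc B0)\<^sup>2"
        by (meson le_trans mult_le_mono)
      then show ?thesis by (simp only: mult.commute)
    qed
    then have "limsup (\<lambda>n. ereal (1 / real n * ln (real (w 0 n))))
        \<le> limsup (\<lambda>n. ereal (1 / real n * ln (real (min_subcover (X 0) (orbit_join symbol_cover n)))))"
      by (rule limsup_ln_le_of_le_mult)
    also have "\<dots> \<le> h_top X d nsft_shift"
      unfolding h_top_def by (rule SUP_upper[OF symbol_cover_admissible])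
    finally show "limsup (\<lambda>n. ereal (1 / real n * ln (real (w 0 n)))) \<le> h_top X d nsft_shift" .
  qed
qed

section \<open>Matrix products count words\<close>

lemma mat_seq_prod_Suc: "k < n \<Longrightarrow> mat_seq_prod L k (Suc n) = mat_seq_prod L k n * L n"
  by (simp add: mat_seq_prod_def)

lemma mat_seq_prod_carrier: "k < n \<Longrightarrow> mat_seq_prod L k n \<in> carrier_mat (l k) (l n)"
proof (induction n)
  case (Suc n)
  show ?case
  proof (cases "k = n")
    case True
    then show ?thesis using dim by (simp add: mat_seq_prod_def)
  next
    case False
    then show ?thesis using Suc dim by (auto simp: mat_seq_prod_Suc intro!: mult_carrier_mat)
  qed
qed simp

lemma entry_nonneg: "a < l i \<Longrightarrow> b < l (Suc i) \<Longrightarrow> L i $$ (a, b) \<ge> 0"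
  using entry_cases by fastforce

abbreviation "words_to k n b \<equiv> {x \<in> words l L k n. x n = Suc b}"

lemma card_words_to_self: "b < l k \<Longrightarrow> card (words_to k k b) = 1"
proof -
  assume b: "b < l k"
  have "words_to k k b = {\<lambda>i\<in>{k}. Suc b}"
    using b by (auto simp: words_def PiE_iff extensional_def fun_eq_iff)
  then show ?thesis by simp
qed

text \<open>Deleting the last symbol identifies these words with the disjoint union, over all
  admissible predecessors \<open>a\<close>, of the words ending in the symbol of
  \<open>a\<close>.\<close>

lemma card_words_to_Suc:
  assumes "k \<le> n" "b < l (Suc n)"
  shows "real (card (words_to k (Suc n) b)) = (\<Sum>a<l n. real (card (words_to k n a)) * L n $$ (a, b))"
proof -
  let ?P = "{a. a < l n \<and> L n $$ (a, b) = 1}"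
  let ?f = "\<lambda>x. restrict x {k..n}"
  let ?g = "\<lambda>x. x(Suc n := Suc b)"
  have "bij_betw ?f (words_to k (Suc n) b) (\<Union>a\<in>?P. words_to k n a)"
  proof (rule bij_betw_byWitness[where f' = ?g])
    show "\<forall>x\<in>words_to k (Suc n) b. ?g (?f x) = x"
      by (auto simp: words_def PiE_iff extensional_def fun_eq_iff)
    show "\<forall>x\<in>\<Union>a\<in>?P. words_to k n a. ?f (?g x) = x"
      by (auto simp: words_def PiE_iff extensional_def fun_eq_iff)
    show "?f ` words_to k (Suc n) b \<subseteq> (\<Union>a\<in>?P. words_to k n a)"
    proof
      fix u assume "u \<in> ?f ` words_to k (Suc n) b"
      then obtain x where x: "x \<in> words l L k (Suc n)" "x (Suc n) = Suc b" "u = ?f x" by blast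
      have "x n \<in> {1..l n}" "symb_entry (L n) (x n) (x (Suc n)) = 1"
        using x(1) assms(1) by (auto simp: words_def PiE_iff)
      then have "x n - 1 \<in> ?P" "x n = Suc (x n - 1)" using x(2) by (auto simp: symb_entry_def)
      moreover have "u \<in> words l L k n" using x(1,3) by (auto simp: words_def PiE_iff)
      ultimately show "u \<in> (\<Union>a\<in>?P. words_to k n a)" using x(3) assms(1) by auto
    qed
    show "?g ` (\<Union>a\<in>?P. words_to k n a) \<subseteq> words_to k (Suc n) b"
      using assms by (auto simp: words_def PiE_iff extensional_def symb_entry_def less_Suc_eq)
  qed
  then have "card (words_to k (Suc n) b) = card (\<Union>a\<in>?P. words_to k n a)"
    by (rule bij_betw_same_card)
  also have "\<dots> = (\<Sum>a\<in>?P. card (words_to k n a))"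
    using finite_words by (intro card_UN_disjoint) auto
  finally have "real (card (words_to k (Suc n) b)) = (\<Sum>a\<in>?P. real (card (words_to k n a)))" by simp
  \<comment> \<open>Entries are \<open>0\<close> or \<open>1\<close>, so multiplying by them is the
    same as restricting the sum to \<open>?P\<close>.\<close>
  also have "\<dots> = (\<Sum>a<l n. real (card (words_to k n a)) * L n $$ (a, b))"
    using entry_cases[OF _ assms(2)] by (intro sum.mono_neutral_cong_left) auto
  finally show ?thesis .
qed

text \<open>Allows the absolute values in the norm to be dropped.\<close>

lemma mat_seq_prod_nonneg:
  "k < n \<Longrightarrow> a < l k \<Longrightarrow> b < l n \<Longrightarrow> mat_seq_prod L k n $$ (a, b) \<ge> 0"
proof (induction n arbitrary: b)
  case (Suc n)
  show ?case
  proof (cases "k = n")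
    case True
    then show ?thesis using Suc entry_nonneg by (simp add: mat_seq_prod_def)
  next
    case False
    then have "k < n" using Suc by simp
    then show ?thesis
      using Suc dim[of n] mat_seq_prod_carrier[OF \<open>k < n\<close>]
      by (auto simp: mat_seq_prod_Suc scalar_prod_def intro!: sum_nonneg mult_nonneg_nonneg entry_nonneg)
  qed
qed simp

text \<open>Column sums and counts of words by last symbol obey the same recursion: as row vectors,
  both are multiplied by \<open>L n\<close> on the right.\<close>

lemma mat_seq_prod_col_sum:
  "k < n \<Longrightarrow> b < l n \<Longrightarrow> (\<Sum>a<l k. mat_seq_prod L k n $$ (a, b)) = real (card (words_to k n b))"
proof (induction n arbitrary: b)
  case (Suc n)
  show ?case
  proof (cases "k = n")
    \<comment> \<open>The product is the single factor \<open>L k\<close>, and exactly one word on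
      \<open>{k..k}\<close> ends in a given symbol.\<close>
    case True
    then show ?thesis using Suc
      by (simp add: mat_seq_prod_def card_words_to_Suc card_words_to_self)
  next
    case False
    then have "k < n" using Suc by simp
    note carr = dim[of n] mat_seq_prod_carrier[OF \<open>k < n\<close>]
    have "(\<Sum>a<l k. mat_seq_prod L k (Suc n) $$ (a, b))
        = (\<Sum>a<l k. \<Sum>j<l n. mat_seq_prod L k n $$ (a, j) * L n $$ (j, b))"
      using carr Suc(3) \<open>k < n\<close>
      by (intro sum.cong) (auto simp: mat_seq_prod_Suc scalar_prod_def lessThan_atLeast0 intro!: sum.cong)
    also have "\<dots> = (\<Sum>j<l n. (\<Sum>a<l k. mat_seq_prod L k n $$ (a, j)) * L n $$ (j, b))"
      by (subst sum.swap) (simp add: sum_distrib_right)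
    also have "\<dots> = (\<Sum>j<l n. real (card (words_to k n j)) * L n $$ (j, b))"
      using Suc.IH[OF \<open>k < n\<close>] by simp
    also have "\<dots> = real (card (words_to k (Suc n) b))"
      using card_words_to_Suc[of k n b] \<open>k < n\<close> Suc(3) by simp
    finally show ?thesis .
  qed
qed simp

text \<open>Summing the column sums amounts to splitting the words by their last symbol.\<close>

lemma entry_norm_mat_seq_prod:
  assumes "k < n"
  shows "entry_norm (mat_seq_prod L k n) = real (w k n)"
proof -
  have "entry_norm (mat_seq_prod L k n) = (\<Sum>a<l k. \<Sum>b<l n. mat_seq_prod L k n $$ (a, b))"
    unfolding entry_norm_def using mat_seq_prod_carrier[OF assms] mat_seq_prod_nonneg[OF assms]
    by (auto intro!: sum.cong)
  also have "\<dots> = (\<Sum>b<l n. \<Sum>a<l k. mat_seq_prod L k n $$ (a, b))" by (rule sum.swap)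
  also have "\<dots> = (\<Sum>b<l n. real (card (words_to k n b)))"
    using mat_seq_prod_col_sum[OF assms] by simp
  also have "\<dots> = real (card (\<Union>b<l n. words_to k n b))"
    using finite_words by (subst card_UN_disjoint) auto
  also have "(\<Union>b<l n. words_to k n b) = words l L k n"
  proof
    show "words l L k n \<subseteq> (\<Union>b<l n. words_to k n b)"
    proof
      fix x assume x: "x \<in> words l L k n"
      then have "x n \<in> {1..l n}" using assms by (auto simp: words_def PiE_iff)
      then show "x \<in> (\<Union>b<l n. words_to k n b)" using x by (auto intro!: bexI[of _ "x n - 1"])
    qed
  qed auto
  finally show ?thesis by (simp add: word_count_def)
qed

end

theorem theorem4p5:
  fixes l :: "nat \<Rightarrow> nat" and L :: "nat \<Rightarrow> real mat"
  assumes dim: "\<And>i. L i \<in> carrier_mat (l i) (l (Suc i))"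
    and zero_one: "\<And>i. elements_mat (L i) \<subseteq> {0, 1}"
    and A1: "reduced_seq l L"
    and A2: "\<exists>B. \<forall>i. l i \<le> B"
  shows "h_top (nsft_space l L) (nsft_dist l L) nsft_shift
           = limsup (\<lambda>n. ereal (1 / real n * ln (real (word_count l L 0 n))))
       \<and> limsup (\<lambda>n. ereal (1 / real n * ln (real (word_count l L 0 n))))
           = limsup (\<lambda>n. ereal (1 / real n * ln (entry_norm (mat_seq_prod L 0 n))))"
proof -
  interpret nsft l L by unfold_locales (fact dim zero_one A1)+
  have "(\<lambda>n. ereal (1 / real n * ln (real (w 0 n))))
      = (\<lambda>n. ereal (1 / real n * ln (entry_norm (mat_seq_prod L 0 n))))" (is "?f = ?g")
  proof
    \<comment> \<open>At \<open>n = 0\<close> the factor \<open>1 / real 0\<close> is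
      \<open>0\<close>, so both terms vanish although \<open>mat_seq_prod L 0 0\<close> is
      \<open>L 0\<close> and not an empty product.\<close>
    show "?f n = ?g n" for n by (cases "n = 0") (simp_all add: entry_norm_mat_seq_prod)
  qed
  then show ?thesis using h_top_eq_word_growth[OF A2] by (simp only: simp_thms)
qed

end
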